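(* For $s>0$ let $$\xi_0(s):=2\,{}_2F_1(1,s;s+1;-1)-1=\int_0^1\frac{1-x}{1+x}\,s\,x^{s-1}\,dx,$$ $$\xi_1(s):=\frac{1-\xi_0(s)}{2s},\qquad \xi_2(s):=2s\,\xi_0(s),\qquad \xi_3(s):=\frac{1-\xi_0(s)}{2s\,\xi_0(s)}.$$ The functions $\xi_0,\xi_1,\xi_2,\xi_3$ are continuous on $(0,\infty)$. Moreover: (i) $\xi_0$ is decreasing and maps $(0,\infty)$ onto $(0,1)$, and the function $s\mapsto s^2\xi_0'(s)$ is decreasing on $(0,\infty)$; (ii) $\xi_1$ is decreasing and maps $(0,\infty)$ onto $(0,\ln 2)$; (iii) $\xi_2$ is increasing and maps $(0,\infty)$ onto $(0,1)$; (iv) $\xi_3$ is increasing and maps $(0,\infty)$ onto $(\ln 2,1)$. Consequently, since these functions are monotone, each of $\xi_0,\xi_1,\xi_2,\xi_3$ extends continuously to $[0,\infty)$ and can also be defined by continuity at $\infty$ (i.e. it has finite limits as $s\to0^+$ and as $s\to\infty$).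
   Context: ${}_2F_1(a,b;c;z)$ denotes the Gauss hypergeometric function; for $0<\Re b<\Re c$ it is given by ${}_2F_1(a,b;c;z)=\frac{\Gamma(c)}{\Gamma(b)\Gamma(c-b)}\int_0^1\frac{x^{b-1}(1-x)^{c-b-1}}{(1-zx)^a}\,dx$, which is also used at $z=-1$; thus ${}_2F_1(1,s;s+1;-1)=\int_0^1\frac{s x^{s-1}}{1+x}\,dx$. "Increasing" and "decreasing" are meant in the strict sense. *)

theory Defs
  imports "HOL-Analysis.Analysis"
begin

text \<open>
  The Gauss hypergeometric function through Euler's integral, to be used only for
  \<open>0 < Re b < Re c\<close> and \<open>z\<close> outside \<open>[1, \<infinity>)\<close>. Then \<open>1 - z x\<close> avoids the non-positive real
  axis for \<open>0 \<le> x \<le> 1\<close>, so the principal power is the correct branch.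
\<close>
definition hyp2F1 :: "complex \<Rightarrow> complex \<Rightarrow> complex \<Rightarrow> complex \<Rightarrow> complex" where
  "hyp2F1 a b c z =
     Gamma c / (Gamma b * Gamma (c - b)) *
     integral {0..1} (\<lambda>x::real. complex_of_real x powr (b - 1) *
       complex_of_real (1 - x) powr (c - b - 1) / (1 - z * complex_of_real x) powr a)"

text \<open>
  All four functions are only of interest for \<open>s > 0\<close>. There the hypergeometric value is real,
  so \<open>Re\<close> loses nothing.
\<close>
definition xi0 :: "real \<Rightarrow> real" where
  "xi0 s = Re (2 * hyp2F1 1 (complex_of_real s) (complex_of_real s + 1) (-1) - 1)"

definition xi1 :: "real \<Rightarrow> real" where
  "xi1 s = (1 - xi0 s) / (2 * s)"

definition xi2 :: "real \<Rightarrow> real" where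
  "xi2 s = 2 * s * xi0 s"

definition xi3 :: "real \<Rightarrow> real" where
  "xi3 s = (1 - xi0 s) / (2 * s * xi0 s)"

end

theory Submission
  imports Defs "HOL-Real_Asymp.Real_Asymp"
begin

text \<open>
  Everything is read off from the moments \<open>moment w s\<close>, the integral of \<open>w x * x powr s\<close> over the
  unit interval, for a few explicit continuous weights \<open>w\<close>. Write \<open>M1\<close>, \<open>M2\<close>, \<open>M3\<close> for the moments
  of \<open>1 / (1 + x)\<close>, \<open>1 / (1 + x)\<^sup>2\<close> and \<open>(1 - x) / (1 + x) ^ 3\<close>. Since \<open>s * x powr (s - 1)\<close> is the
  derivative of \<open>x powr s\<close>, integration by parts (\<open>has_integral_by_parts_moment\<close>) trades Euler's
  integral, whose integrand is singular at \<open>0\<close> for \<open>s < 1\<close>, for a moment and gives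
  \<open>xi0 = 2 * M2\<close>, \<open>xi1 = M1\<close> and \<open>xi2 = 1 - 4 * M3\<close>; moreover \<open>xi3 = xi1 / xi0\<close>.

  A moment of a positive weight is strictly decreasing, because \<open>x powr s\<close> is so for every \<open>x\<close>
  strictly between \<open>0\<close> and \<open>1\<close>. This settles the monotonicity of \<open>xi0\<close>, \<open>xi1\<close> and \<open>xi2\<close>. The
  quotient \<open>xi3\<close> is the mean of the increasing function \<open>(1 + x) / 2\<close> with respect to the density
  proportional to \<open>x powr s / (1 + x)\<^sup>2\<close>, and raising \<open>s\<close> shifts mass to the right, so the mean
  grows (\<open>weighted_mean_strict_mono\<close>, an instance of Chebyshev's inequality).

  For the claim on the derivative, write \<open>xi0 s = (1 - 4 * M3 s) / (2 * s)\<close>. Differentiating this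
  form makes \<open>s\<^sup>2 * deriv xi0 s + 1 / 2\<close> equal to twice the integral of
  \<open>(1 - x) / (1 + x) ^ 3\<close> times \<open>x powr s * (1 - s * ln x)\<close>. With \<open>u = - s * ln x\<close> the latter
  factor is \<open>(1 + u) * exp (- u)\<close>, which decreases in \<open>u \<ge> 0\<close>; hence the integrand decreases in
  \<open>s\<close> pointwise.

  As \<open>s\<close> tends to \<open>0\<close> a moment tends to the integral of its weight, and as \<open>s\<close> tends to infinity it
  tends to \<open>0\<close>. These limits of the four functions are the endpoints of their ranges, by the
  intermediate value theorem.
\<close>

section \<open>Moments of a weight on the unit interval\<close>

definition moment :: "(real \<Rightarrow> real) \<Rightarrow> real \<Rightarrow> real" where
  "moment w s = integral {0..1} (\<lambda>x. w x * x powr s)"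

lemma continuous_on_powr_unit [continuous_intros]:
  "s > 0 \<Longrightarrow> continuous_on {0..1} (\<lambda>x::real. x powr s)"
  by (intro continuous_on_powr' continuous_intros) auto

lemma moment_integrable:
  fixes w :: "real \<Rightarrow> real"
  assumes "continuous_on {0..1} w" "s > 0"
  shows "(\<lambda>x. w x * x powr s) integrable_on {0..1}"
  using assms by (intro integrable_continuous_real continuous_on_mult continuous_on_powr_unit)

lemma moment_has_integral:
  assumes "continuous_on {0..1} w" "s > 0"
  shows "((\<lambda>x. w x * x powr s) has_integral moment w s) {0..1}"
  unfolding moment_def using moment_integrable[OF assms] by (rule integrable_integral)

text \<open>
  The primitive \<open>\<phi> x * x powr s\<close> is continuous up to \<open>x = 0\<close> and vanishes there, so the fundamental
  theorem needs its derivative in the open interval only. This also yields the integrability of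
  the possibly unbounded integrand.
\<close>
lemma has_integral_by_parts_moment:
  fixes \<phi> \<phi>' :: "real \<Rightarrow> real"
  assumes "s > 0" and cont: "continuous_on {0..1} \<phi>" "continuous_on {0..1} \<phi>'"
    and deriv: "\<And>x. 0 < x \<Longrightarrow> x < 1 \<Longrightarrow> (\<phi> has_real_derivative \<phi>' x) (at x)"
  shows "((\<lambda>x. \<phi> x * s * x powr (s - 1)) has_integral \<phi> 1 - moment \<phi>' s) {0..1}"
proof -
  let ?F = "\<lambda>x. \<phi> x * x powr s"
  have "((\<lambda>x. \<phi>' x * x powr s + \<phi> x * s * x powr (s - 1)) has_integral ?F 1 - ?F 0) {0..1}"
  proof (rule fundamental_theorem_of_calculus_interior)
    show "continuous_on {0..1} ?F"
      by (intro continuous_intros cont \<open>s > 0\<close>)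
    fix x :: real assume x: "x \<in> {0<..<1}"
    have "(?F has_real_derivative \<phi>' x * x powr s + s * x powr (s - 1) * \<phi> x) (at x)"
      using x by (intro DERIV_mult deriv has_real_derivative_powr) auto
    then show "(?F has_vector_derivative \<phi>' x * x powr s + \<phi> x * s * x powr (s - 1)) (at x)"
      by (simp add: has_real_derivative_iff_has_vector_derivative mult_ac)
  qed simp
  from has_integral_diff[OF this moment_has_integral[OF cont(2) \<open>s > 0\<close>]]
  show ?thesis by simp
qed

lemma moment_one:
  assumes "s > 0" shows "moment (\<lambda>_. 1) s = 1 / (s + 1)"
  unfolding moment_def using has_integral_powr_from_0[of s 1] assms
  by (auto intro!: integral_unique)

lemma moment_cmult: "moment (\<lambda>x. c * w x) s = c * moment w s"
  by (simp add: moment_def mult.assoc)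

lemma moment_strict_antimono:
  assumes cont: "continuous_on {0..1} w" and pos: "\<And>x. 0 < x \<Longrightarrow> x < 1 \<Longrightarrow> w x > 0"
    and "0 < s" "s < t"
  shows "moment w t < moment w s"
  unfolding moment_def
proof (rule integral_less_real)
  fix x :: real assume "x \<in> {0<..<1}"
  then show "w x * x powr t < w x * x powr s"
    using pos[of x] \<open>s < t\<close> by (intro mult_strict_left_mono powr_less_mono') auto
qed (use assms in \<open>auto intro!: continuous_intros\<close>)

lemma bounded_unit:
  fixes w :: "real \<Rightarrow> real"
  assumes "continuous_on {0..1} w"
  obtains C where "\<And>x. x \<in> {0..1} \<Longrightarrow> \<bar>w x\<bar> \<le> C"
proof -
  have "bounded (w ` {0..1})"
    by (intro compact_imp_bounded compact_continuous_image assms compact_Icc)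
  then show ?thesis using that unfolding bounded_iff by force
qed

text \<open>
  If \<open>C\<close> bounds the weight, the moment is in absolute value at most \<open>C\<close> times that of the
  constant weight \<open>1\<close>, which is \<open>1 / (s + 1)\<close>. The limit at \<open>0\<close> below rests on the same comparison for \<open>1 - x powr s\<close>.
\<close>
lemma moment_tendsto_at_top:
  assumes "continuous_on {0..1} w"
  shows "(moment w \<longlongrightarrow> 0) at_top"
proof -
  obtain C where C: "\<And>x. x \<in> {0..1} \<Longrightarrow> \<bar>w x\<bar> \<le> C" using bounded_unit[OF assms] by blast
  have bound: "\<bar>moment w s\<bar> \<le> C * (1 / (s + 1))" if "s > 0" for s
  proof -
    have "norm (integral {0..1} (\<lambda>x. w x * x powr s)) \<le> integral {0..1} (\<lambda>x. C * x powr s)"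
      by (rule integral_norm_bound_integral)
         (use that C assms in \<open>auto intro!: integrable_continuous_real continuous_intros
            mult_right_mono simp: abs_mult\<close>)
    also have "\<dots> = C * moment (\<lambda>_. 1) s" by (simp add: moment_def)
    finally show ?thesis using that by (simp add: moment_def[of w, symmetric] moment_one)
  qed
  have "((\<lambda>s. C * (1 / (s + 1))) \<longlongrightarrow> 0) at_top" by real_asymp
  then show ?thesis
    by (rule Lim_null_comparison[rotated])
       (use bound in \<open>auto intro!: eventually_mono[OF eventually_gt_at_top[of 0]]\<close>)
qed

lemma moment_tendsto_at_right_0:
  assumes "continuous_on {0..1} w"
  shows "(moment w \<longlongrightarrow> integral {0..1} w) (at_right 0)"
proof -
  obtain C where C: "\<And>x. x \<in> {0..1} \<Longrightarrow> \<bar>w x\<bar> \<le> C" using bounded_unit[OF assms] by blast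
  have bound: "\<bar>moment w s - integral {0..1} w\<bar> \<le> C * (1 - 1 / (s + 1))" if "s > 0" for s
  proof -
    have "norm (integral {0..1} (\<lambda>x. w x * x powr s - w x)) \<le>
        integral {0..1} (\<lambda>x. C * (1 - x powr s))"
    proof (rule integral_norm_bound_integral)
      fix x :: real assume x: "x \<in> {0..1}"
      then have "x powr s \<le> 1" using that by (simp add: powr_le1)
      then have "\<bar>w x\<bar> * \<bar>1 - x powr s\<bar> \<le> C * (1 - x powr s)"
        using C[OF x] by (intro mult_mono) auto
      moreover have "w x * x powr s - w x = - (w x * (1 - x powr s))"
        by (simp add: algebra_simps)
      ultimately show "norm (w x * x powr s - w x) \<le> C * (1 - x powr s)"
        by (simp only: real_norm_def abs_minus_cancel abs_mult)
    qed (use that assms in \<open>auto intro!: integrable_continuous_real continuous_intros\<close>)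
    also have "integral {0..1} (\<lambda>x. C * (1 - x powr s)) = C * (1 - moment (\<lambda>_. 1) s)"
      using that by (simp add: moment_def integral_diff integrable_continuous_real continuous_intros)
    also have "integral {0..1} (\<lambda>x. w x * x powr s - w x) = moment w s - integral {0..1} w"
      unfolding moment_def
      by (intro integral_diff moment_integrable integrable_continuous_real assms that)
    finally show ?thesis using that by (simp add: moment_one)
  qed
  have "((\<lambda>s. C * (1 - 1 / (s + 1))) \<longlongrightarrow> 0) (at_right 0)" by real_asymp
  then have "((\<lambda>s. moment w s - integral {0..1} w) \<longlongrightarrow> 0) (at_right 0)"
    by (rule Lim_null_comparison[rotated])
       (use bound in \<open>auto intro!: eventually_mono[OF eventually_at_right_less[of 0]]\<close>)
  then show ?thesis using LIM_zero_iff by blast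
qed

lemma continuous_on_powr_ln_unit [continuous_intros]:
  assumes "s > 0"
  shows "continuous_on {0..1} (\<lambda>x::real. x powr s * ln x)"
proof -
  have "((\<lambda>x::real. x powr s * ln x) \<longlongrightarrow> 0 powr s * ln 0) (at_right 0)"
    using assms by simp real_asymp
  then have "((\<lambda>x::real. x powr s * ln x) \<longlongrightarrow> 0 powr s * ln 0) (at 0 within {0..1})"
    by (simp add: at_within_Icc_at_right)
  moreover have "((\<lambda>x::real. x powr s * ln x) \<longlongrightarrow> y powr s * ln y) (at y within {0..1})"
    if "y > 0" for y
    using that by (intro tendsto_intros) auto
  ultimately show ?thesis unfolding continuous_on_def by (metis atLeastAtMost_iff order_le_less)
qed

text \<open>
  Both \<open>exp z - 1 - z \<le> z * (exp z - 1)\<close> and \<open>exp z - 1 \<le> z * exp z\<close> are rearrangements of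
  \<open>1 - z \<le> exp (- z)\<close>. They give the bound for \<open>z \<ge> 0\<close>; for negative \<open>z\<close> the second is
  replaced by \<open>1 - exp z \<le> - z\<close>.
\<close>
lemma exp_remainder_bound: "\<bar>exp z - 1 - z\<bar> \<le> z\<^sup>2 * exp \<bar>z\<bar>" for z :: real
proof -
  have "exp z * (1 - z) \<le> exp z * exp (- z)"
    using exp_ge_add_one_self[of "- z"] by (intro mult_left_mono) auto
  then have *: "exp z * (1 - z) \<le> 1" by (simp add: exp_minus)
  have "exp z - 1 - z \<le> z * (exp z - 1)" using * by (simp add: algebra_simps)
  also have "\<dots> \<le> z\<^sup>2 * exp \<bar>z\<bar>"
  proof (cases "z \<ge> 0")
    case True
    have "z * (exp z - 1) \<le> z * (z * exp z)"
      using * True by (intro mult_left_mono) (auto simp: algebra_simps)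
    then show ?thesis using True by (simp add: power2_eq_square mult.assoc)
  next
    case False
    have "(- z) * (1 - exp z) \<le> (- z) * (- z)"
    proof (rule mult_left_mono)
      show "1 - exp z \<le> - z" using exp_ge_add_one_self[of z] by linarith
    qed (use False in auto)
    also have "\<dots> \<le> z\<^sup>2 * exp \<bar>z\<bar>"
      using mult_left_mono[of 1 "exp \<bar>z\<bar>" "z\<^sup>2"] by (simp add: power2_eq_square)
    finally show ?thesis by (simp add: algebra_simps)
  qed
  finally show ?thesis using exp_ge_add_one_self[of z] by linarith
qed

text \<open>
  A first-order Taylor estimate in the exponent that is uniform in \<open>x\<close>, which is what
  differentiation under the integral sign requires. With \<open>u = - ln x\<close> and \<open>h = t - s\<close> the remainder
  is at most \<open>exp (- s * u) * (h * u)\<^sup>2 * exp (\<bar>h\<bar> * u)\<close>. As \<open>\<bar>h\<bar> \<le> s / 2\<close>, half of the decay survives,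
  and \<open>u\<^sup>2 * exp (- s * u / 2) \<le> 8 / s\<^sup>2\<close> because \<open>v\<^sup>2 / 2 \<le> exp v\<close> for \<open>v = s * u / 2\<close>.
\<close>
lemma powr_remainder_bound:
  fixes x s t :: real
  assumes "0 \<le> x" "x \<le> 1" "s > 0" "\<bar>t - s\<bar> \<le> s / 2"
  shows "\<bar>x powr t - x powr s - (t - s) * (x powr s * ln x)\<bar> \<le> 8 / s\<^sup>2 * (t - s)\<^sup>2"
proof (cases "x = 0")
  case False
  define u where "u = - ln x"
  have u: "u \<ge> 0" using assms False by (simp add: u_def)
  define h where "h = t - s"
  have split: "x powr t - x powr s - h * (x powr s * ln x)
      = exp (- (s * u)) * (exp (- (h * u)) - 1 - (- (h * u)))"
    using False by (simp add: powr_def u_def h_def algebra_simps flip: exp_add)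
  have hu: "\<bar>h\<bar> * u \<le> s / 2 * u" using assms u by (intro mult_right_mono) (auto simp: h_def)
  have "\<bar>exp (- (h * u)) - 1 - (- (h * u))\<bar> \<le> (h * u)\<^sup>2 * exp (\<bar>h\<bar> * u)"
    using exp_remainder_bound[of "- (h * u)"] u by (simp add: abs_mult)
  also have "\<dots> \<le> (h * u)\<^sup>2 * exp (s / 2 * u)" using hu by (intro mult_left_mono) auto
  finally have "\<bar>x powr t - x powr s - h * (x powr s * ln x)\<bar>
      \<le> exp (- (s * u)) * ((h * u)\<^sup>2 * exp (s / 2 * u))"
    unfolding split abs_mult by (simp add: mult_left_mono)
  also have "\<dots> = h\<^sup>2 * (u\<^sup>2 * exp (- (s / 2 * u)))"
    by (simp add: power_mult_distrib mult.assoc mult.left_commute flip: exp_add)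
  also have "\<dots> \<le> h\<^sup>2 * (8 / s\<^sup>2)"
  proof (rule mult_left_mono)
    have "0 \<le> s / 2 * u" using u assms by simp
    have "(s / 2 * u)\<^sup>2 / 2 \<le> exp (s / 2 * u)"
      using exp_lower_Taylor_quadratic[of "s / 2 * u"] \<open>0 \<le> s / 2 * u\<close> by linarith
    then show "u\<^sup>2 * exp (- (s / 2 * u)) \<le> 8 / s\<^sup>2"
      using assms by (simp add: exp_minus field_simps power2_eq_square)
  qed auto
  finally show ?thesis by (simp add: h_def mult.commute)
qed (use assms in auto)

lemma moment_has_derivative:
  assumes cont: "continuous_on {0..1} w" and "s > 0"
  shows "(moment w has_real_derivative integral {0..1} (\<lambda>x. w x * (x powr s * ln x))) (at s)"
proof -
  obtain C where C: "\<And>x. x \<in> {0..1} \<Longrightarrow> \<bar>w x\<bar> \<le> C" using bounded_unit[OF cont] by blast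
  define D where "D = integral {0..1} (\<lambda>x. w x * (x powr s * ln x))"
  have D: "((\<lambda>x. w x * (x powr s * ln x)) has_integral D) {0..1}"
    unfolding D_def
    by (intro integrable_integral integrable_continuous_real continuous_intros cont \<open>s > 0\<close>)
  have bound: "\<bar>(moment w t - moment w s) / (t - s) - D\<bar> \<le> C * (8 / s\<^sup>2) * \<bar>t - s\<bar>"
    if t: "t \<noteq> s" "\<bar>t - s\<bar> < s / 2" for t
  proof -
    have "t > 0" using t by linarith
    have eq: "((\<lambda>x. w x * x powr t - w x * x powr s - (t - s) * (w x * (x powr s * ln x)))
        has_integral moment w t - moment w s - (t - s) * D) {0..1}"
      by (intro has_integral_diff has_integral_mult_right D moment_has_integral cont
            \<open>s > 0\<close> \<open>t > 0\<close>)
    have "norm (moment w t - moment w s - (t - s) * D) \<le>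
        C * (8 / s\<^sup>2 * (t - s)\<^sup>2) * measure lborel (cbox 0 (1::real))"
    proof (rule has_integral_bound)
      show "0 \<le> C * (8 / s\<^sup>2 * (t - s)\<^sup>2)" using C[of 0] by simp
      show "((\<lambda>x. w x * x powr t - w x * x powr s - (t - s) * (w x * (x powr s * ln x)))
        has_integral moment w t - moment w s - (t - s) * D) (cbox 0 1)" using eq by simp
      fix x :: real assume x: "x \<in> cbox 0 1"
      have "\<bar>w x\<bar> * \<bar>x powr t - x powr s - (t - s) * (x powr s * ln x)\<bar>
          \<le> C * (8 / s\<^sup>2 * (t - s)\<^sup>2)"
        using x t \<open>s > 0\<close> C[of x] by (intro mult_mono powr_remainder_bound) auto
      then show "norm (w x * x powr t - w x * x powr s - (t - s) * (w x * (x powr s * ln x)))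
          \<le> C * (8 / s\<^sup>2 * (t - s)\<^sup>2)"
        by (simp add: algebra_simps flip: abs_mult)
    qed
    then have "\<bar>moment w t - moment w s - (t - s) * D\<bar> \<le> C * (8 / s\<^sup>2) * \<bar>t - s\<bar> * \<bar>t - s\<bar>"
      by (simp add: power2_eq_square mult.assoc flip: abs_mult)
    moreover have "(moment w t - moment w s) / (t - s) - D
        = (moment w t - moment w s - (t - s) * D) / (t - s)"
      using t by (simp add: field_simps)
    ultimately show ?thesis using t by (simp add: pos_divide_le_eq)
  qed
  have "((\<lambda>t. C * (8 / s\<^sup>2) * \<bar>t - s\<bar>) \<longlongrightarrow> C * (8 / s\<^sup>2) * \<bar>s - s\<bar>) (at s)"
    by (intro tendsto_intros)
  then have lim: "((\<lambda>t. C * (8 / s\<^sup>2) * \<bar>t - s\<bar>) \<longlongrightarrow> 0) (at s)" by simp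
  have ev: "\<forall>\<^sub>F t in at s. norm ((moment w t - moment w s) / (t - s) - D) \<le> C * (8 / s\<^sup>2) * \<bar>t - s\<bar>"
    unfolding eventually_at using \<open>s > 0\<close> bound
    by (intro exI[of _ "s / 2"]) (auto simp: dist_real_def)
  have "((\<lambda>t. (moment w t - moment w s) / (t - s) - D) \<longlongrightarrow> 0) (at s)"
    by (rule Lim_null_comparison[OF ev lim])
  then show ?thesis
    unfolding has_field_derivative_iff D_def[symmetric] using LIM_zero_iff by blast
qed

lemma continuous_on_moment:
  assumes "continuous_on {0..1} w"
  shows "continuous_on {0<..} (moment w)"
  by (rule DERIV_continuous_on[OF has_field_derivative_at_within[OF moment_has_derivative]])
     (use assms in auto)

lemma moment_pos:
  assumes "continuous_on {0..1} w" "\<And>x. 0 < x \<Longrightarrow> x < 1 \<Longrightarrow> w x > 0" "s > 0"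
  shows "moment w s > 0"
proof -
  have "integral {0..1} (\<lambda>x::real. 0) < integral {0..1} (\<lambda>x. w x * x powr s)"
    by (rule integral_less_real) (use assms in \<open>auto intro!: continuous_intros\<close>)
  then show ?thesis by (simp add: moment_def)
qed

section \<open>Monotonicity of weighted means\<close>

lemma integral_pos_if_somewhere_pos:
  fixes f :: "real \<Rightarrow> real"
  assumes "continuous_on {a..b} f" "\<And>x. x \<in> {a..b} \<Longrightarrow> f x \<ge> 0"
    and "y \<in> {a..b}" "f y > 0" "a < b"
  shows "integral {a..b} f > 0"
proof -
  have "integral {a..b} f \<noteq> 0" using integral_eq_0_iff[of a b f] assms by fastforce
  moreover have "integral {a..b} f \<ge> 0"
    using assms by (intro integral_nonneg integrable_continuous_real) auto
  ultimately show ?thesis by linarith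
qed

text \<open>
  Let \<open>c\<close> be the mean of \<open>p\<close> for the exponent \<open>s\<close>, attained by \<open>p\<close> at a point \<open>y\<close>. Then
  \<open>(p x - c) * w x * x powr s\<close> has integral \<open>0\<close>, and subtracting \<open>y powr (t - s)\<close> times it from
  \<open>(p x - c) * w x * x powr t\<close> leaves the integral unchanged but replaces \<open>x powr (t - s)\<close> by
  \<open>x powr (t - s) - y powr (t - s)\<close>. This has the same sign as \<open>p x - c\<close>, so the integrand
  becomes nonnegative.
\<close>
lemma weighted_mean_strict_mono:
  fixes p w :: "real \<Rightarrow> real"
  assumes cont: "continuous_on {0..1} p" "continuous_on {0..1} w"
    and wpos: "\<And>x. x \<in> {0..1} \<Longrightarrow> w x > 0"
    and mono: "strict_mono_on {0..1} p" and st: "0 < s" "s < t"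
  shows "moment (\<lambda>x. p x * w x) s / moment w s < moment (\<lambda>x. p x * w x) t / moment w t"
proof -
  define c where "c = moment (\<lambda>x. p x * w x) s / moment w s"
  have t: "0 < t" using st by simp
  have cpw: "continuous_on {0..1} (\<lambda>x. p x * w x)" by (intro continuous_intros cont)
  have pos: "moment w s > 0" "moment w t > 0"
    using cont wpos st t by (auto intro!: moment_pos)
  have scale: "moment (\<lambda>x. a * w x) s = a * moment w s" for a
    by (simp add: moment_def mult.assoc)
  have shift: "((\<lambda>x. (p x - c) * w x * x powr r) has_integral
      moment (\<lambda>x. p x * w x) r - c * moment w r) {0..1}" if "r > 0" for r
    using has_integral_diff[OF moment_has_integral[OF cpw that]
        has_integral_mult_right[OF moment_has_integral[OF cont(2) that], of c]]
    by (simp add: algebra_simps)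
  have less: "moment f s < moment g s"
    if "continuous_on {0..1} f" "continuous_on {0..1} g" "\<And>x. 0 < x \<Longrightarrow> x < 1 \<Longrightarrow> f x < g x" for f g
    unfolding moment_def using that st by (intro integral_less_real continuous_intros) auto
  have p: "p x < p y" if "0 \<le> x" "x < y" "y \<le> 1" for x y
    using mono that by (auto intro: strict_mono_onD)
  have "p 0 * moment w s < moment (\<lambda>x. p x * w x) s" "moment (\<lambda>x. p x * w x) s < p 1 * moment w s"
    unfolding scale[symmetric] using p wpos
    by (auto intro!: less continuous_intros cont mult_strict_right_mono)
  then have "p 0 < c" "c < p 1" using pos by (auto simp: c_def field_simps)
  then obtain y where y: "0 \<le> y" "y \<le> 1" "p y = c" using IVT'[of p 0 c 1] cont by auto
  then have y01: "0 < y" "y < 1" using \<open>p 0 < c\<close> \<open>c < p 1\<close> by (auto simp: order_less_le)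
  define f where "f = (\<lambda>x. (p x - c) * w x * x powr t - y powr (t - s) * ((p x - c) * w x * x powr s))"
  have f_eq: "f x = (p x - p y) * (x powr (t - s) - y powr (t - s)) * (w x * x powr s)" for x
  proof -
    have "x powr t = x powr (t - s) * x powr s" by (simp flip: powr_add)
    then show ?thesis by (simp add: f_def y algebra_simps)
  qed
  have f_pos: "f x > 0" if "0 < x" "x \<le> 1" "x \<noteq> y" for x
  proof -
    have "(p x - p y) * (x powr (t - s) - y powr (t - s)) > 0"
    proof (cases "x < y")
      case True
      then show ?thesis using p[of x y] powr_less_mono2[of "t - s" x y] that y st
        by (intro mult_neg_neg) auto
    next
      case False
      then show ?thesis using p[of y x] powr_less_mono2[of "t - s" y x] that y st
        by (intro mult_pos_pos) auto
    qed
    then show ?thesis unfolding f_eq using that wpos[of x] by auto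
  qed
  have f0: "f 0 = 0" "f y = 0" using st by (simp_all add: f_def y)
  have "0 < integral {0..1} f"
  proof (rule integral_pos_if_somewhere_pos)
    show "continuous_on {0..1} f" unfolding f_def by (intro continuous_intros cont t st)
    show "f x \<ge> 0" if "x \<in> {0..1}" for x
      using f_pos[of x] f0 that by (cases "x = 0 \<or> x = y") auto
    show "f (y / 2) > 0" using y01 by (intro f_pos) auto
  qed (use y01 in auto)
  also have "integral {0..1} f = moment (\<lambda>x. p x * w x) t - c * moment w t
      - y powr (t - s) * (moment (\<lambda>x. p x * w x) s - c * moment w s)"
    unfolding f_def
    by (intro integral_unique has_integral_diff has_integral_mult_right shift t st)
  also have "moment (\<lambda>x. p x * w x) s - c * moment w s = 0" using pos by (simp add: c_def)
  finally show ?thesis using pos by (simp add: c_def[symmetric] field_simps)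
qed


section \<open>Images of monotone functions on the positive half-line\<close>

lemma monotone_image_onto:
  fixes f :: "real \<Rightarrow> real"
  assumes cont: "continuous_on {0<..} f" and mono: "strict_mono_on {0<..} f"
    and lim0: "(f \<longlongrightarrow> l) (at_right 0)" and liminf: "(f \<longlongrightarrow> u) at_top"
  shows "f ` {0<..} = {l<..<u}"
proof (intro equalityI subsetI)
  have less: "f s < f t" if "0 < s" "s < t" for s t
    using mono that by (auto intro: strict_mono_onD)
  have low: "l \<le> f s" if "s > 0" for s
  proof (rule tendsto_upperbound[OF lim0])
    show "\<forall>\<^sub>F x in at_right 0. f x \<le> f s"
      using eventually_at_right_real[OF that] by eventually_elim (use less in \<open>force intro: less_imp_le\<close>)
  qed simp
  have up: "f s \<le> u" if "s > 0" for s
  proof (rule tendsto_lowerbound[OF liminf])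
    show "\<forall>\<^sub>F x in at_top. f s \<le> f x"
      using eventually_gt_at_top[of s] by eventually_elim (use less that in \<open>force intro: less_imp_le\<close>)
  qed simp
  fix y
  {
    assume "y \<in> f ` {0<..}"
    then obtain s where s: "s > 0" "y = f s" by auto
    then have "f (s / 2) < f s" "f s < f (s + 1)" by (auto intro!: less)
    then show "y \<in> {l<..<u}" using low[of "s / 2"] up[of "s + 1"] s by auto
  next
    assume y: "y \<in> {l<..<u}"
    have "\<exists>s>0. f s < y"
    proof -
      have "\<forall>\<^sub>F s in at_right 0. f s < y \<and> s > 0"
        using y by (intro eventually_conj order_tendstoD(2)[OF lim0] eventually_at_right_less) auto
      then show ?thesis using eventually_happens[of _ "at_right (0::real)"] by fastforce
    qed
    then obtain s where s: "s > 0" "f s < y" by blast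
    have "\<exists>t>s. f t > y"
    proof -
      have "\<forall>\<^sub>F t in at_top. f t > y \<and> t > s"
        using y by (intro eventually_conj order_tendstoD(1)[OF liminf] eventually_gt_at_top) auto
      then show ?thesis using eventually_happens[of _ "at_top :: real filter"] by fastforce
    qed
    then obtain t where t: "t > s" "f t > y" by blast
    have "continuous_on {s..t} f" using s by (intro continuous_on_subset[OF cont]) auto
    then obtain r where "s \<le> r" "r \<le> t" "f r = y" using IVT'[of f s y t] s t by auto
    then show "y \<in> f ` {0<..}" using s by force
  }
qed

lemma antitone_image_onto:
  fixes f :: "real \<Rightarrow> real"
  assumes "continuous_on {0<..} f" and "strict_antimono_on {0<..} f"
    and "(f \<longlongrightarrow> u) (at_right 0)" and "(f \<longlongrightarrow> l) at_top"
  shows "f ` {0<..} = {l<..<u}"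
proof -
  have "(\<lambda>s. - f s) ` {0<..} = {- u<..<- l}"
    using assms by (intro monotone_image_onto tendsto_minus continuous_intros)
      (auto simp: monotone_on_def)
  then have "uminus ` (\<lambda>s. - f s) ` {0<..} = uminus ` {- u<..<- l}" by simp
  then show ?thesis by (simp add: image_image)
qed

lemma continuous_extension_to_0:
  fixes f :: "real \<Rightarrow> real"
  assumes "continuous_on {0<..} f" and lim: "(f \<longlongrightarrow> L) (at_right 0)"
  shows "\<exists>g. continuous_on {0..} g \<and> (\<forall>s>0. g s = f s)"
proof (intro exI conjI)
  define g where "g = (\<lambda>s. if s = 0 then L else f s)"
  show "\<forall>s>0. g s = f s" by (simp add: g_def)
  have gt: "isCont g s" if "s > 0" for s
  proof -
    have "isCont f s" using assms(1) that by (simp add: continuous_on_eq_continuous_at)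
    moreover have "\<forall>\<^sub>F x in nhds s. g x = f x"
      by (rule eventually_mono[OF eventually_nhds_in_open[of "{0<..}" s]])
         (use that in \<open>auto simp: g_def\<close>)
    ultimately show ?thesis using isCont_cong by blast
  qed
  have "(g \<longlongrightarrow> L) (at_right 0)"
    using lim
    by (rule Lim_transform_eventually)
       (rule eventually_mono[OF eventually_at_right_less[of 0]], simp add: g_def)
  then have "continuous (at 0 within {0..}) g"
    by (simp add: g_def continuous_within at_within_Ici_at_right)
  then show "continuous_on {0..} g"
    unfolding continuous_on_eq_continuous_within
    using gt by (metis atLeast_iff continuous_at_imp_continuous_at_within order_le_less)
qed

section \<open>The four functions as moments\<close>

abbreviation M1 :: "real \<Rightarrow> real" where "M1 \<equiv> moment (\<lambda>x. 1 / (1 + x))"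
abbreviation M2 :: "real \<Rightarrow> real" where "M2 \<equiv> moment (\<lambda>x. 1 / (1 + x)\<^sup>2)"
abbreviation M3 :: "real \<Rightarrow> real" where "M3 \<equiv> moment (\<lambda>x. (1 - x) / (1 + x) ^ 3)"

lemma continuous_weights:
  "continuous_on {0..1::real} (\<lambda>x. 1 / (1 + x))"
  "continuous_on {0..1::real} (\<lambda>x. 1 / (1 + x)\<^sup>2)"
  "continuous_on {0..1::real} (\<lambda>x. (1 - x) / (1 + x) ^ 3)"
  by (intro continuous_intros; force)+

text \<open>
  The factor \<open>Gamma (s + 1) / Gamma s\<close> is \<open>s\<close>, and Euler's integral is integrated by parts with
  \<open>\<phi> x = 1 / (1 + x)\<close>.
\<close>
lemma hyp2F1_eq_moment:
  assumes "s > 0"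
  shows "hyp2F1 1 (complex_of_real s) (complex_of_real s + 1) (-1) = complex_of_real (1 / 2 + M2 s)"
proof -
  have "((\<lambda>x. 1 / (1 + x) * s * x powr (s - 1)) has_integral
      1 / (1 + 1) - moment (\<lambda>x. (- 1) * (1 / (1 + x)\<^sup>2)) s) {0..1}"
  proof (rule has_integral_by_parts_moment[OF assms])
    show "continuous_on {0..1::real} (\<lambda>x. (- 1) * (1 / (1 + x)\<^sup>2))"
      by (intro continuous_on_mult_left continuous_weights)
    fix x :: real assume "0 < x" "x < 1"
    then show "((\<lambda>x. 1 / (1 + x)) has_real_derivative (- 1) * (1 / (1 + x)\<^sup>2)) (at x)"
      by (auto intro!: derivative_eq_intros simp: power2_eq_square)
  qed (rule continuous_weights)
  then have I: "((\<lambda>x. 1 / (1 + x) * s * x powr (s - 1)) has_integral 1 / 2 + M2 s) {0..1}"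
    by (simp only: moment_cmult) simp
  let ?f = "\<lambda>x. complex_of_real x powr (complex_of_real s - 1) *
       complex_of_real (1 - x) powr (complex_of_real s + 1 - complex_of_real s - 1) /
       (1 - (- 1) * complex_of_real x) powr 1"
  have "((\<lambda>x. complex_of_real (1 / s * (1 / (1 + x) * s * x powr (s - 1)))) has_integral
      complex_of_real (1 / s * (1 / 2 + M2 s))) {0..1}"
    by (intro has_integral_of_real has_integral_mult_right I)
  then have "(?f has_integral complex_of_real (1 / s * (1 / 2 + M2 s))) {0..1}"
    \<comment> \<open>At \<open>x = 1\<close> the factor \<open>(1 - x) powr 0\<close> is \<open>0 powr 0 = 0\<close>, not \<open>1\<close>, so the integrands differ there.\<close>
  proof (rule has_integral_spike_finite[of "{1}", rotated 2])
    fix x :: real assume x: "x \<in> {0..1} - {1}"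
    have "complex_of_real x powr (complex_of_real s - 1) = complex_of_real (x powr (s - 1))"
      using x powr_of_real[of x "s - 1"] by simp
    moreover have "1 + complex_of_real x = complex_of_real (1 + x)" by simp
    then have "1 + complex_of_real x \<noteq> 0" using x by (simp only: of_real_eq_0_iff) auto
    ultimately show "?f x = complex_of_real (1 / s * (1 / (1 + x) * s * x powr (s - 1)))"
      using x assms by simp
  qed simp
  then have "integral {0..1} ?f = complex_of_real (1 / s * (1 / 2 + M2 s))"
    by (rule integral_unique)
  moreover have "Gamma (complex_of_real s + 1) = of_real s * Gamma (complex_of_real s)"
    using assms by (intro Gamma_plus1) (auto elim!: nonpos_Ints_cases simp: complex_eq_iff)
  moreover have "Gamma (complex_of_real s) \<noteq> 0"
    using Gamma_real_pos[OF assms] by (simp only: Gamma_complex_of_real of_real_eq_0_iff)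
  ultimately show ?thesis using assms by (simp add: hyp2F1_def)
qed

lemma xi0_eq_moment: "s > 0 \<Longrightarrow> xi0 s = 2 * M2 s"
  by (simp add: xi0_def hyp2F1_eq_moment)

lemma xi0_has_integral:
  assumes "s > 0"
  shows "((\<lambda>x. (1 - x) / (1 + x) * s * x powr (s - 1)) has_integral xi0 s) {0..1}"
proof -
  have "((\<lambda>x. (1 - x) / (1 + x) * s * x powr (s - 1)) has_integral
      (1 - 1) / (1 + 1) - moment (\<lambda>x. (- 2) * (1 / (1 + x)\<^sup>2)) s) {0..1}"
  proof (rule has_integral_by_parts_moment[OF assms])
    show "continuous_on {0..1::real} (\<lambda>x. (- 2) * (1 / (1 + x)\<^sup>2))"
      by (intro continuous_on_mult_left continuous_weights)
    show "continuous_on {0..1::real} (\<lambda>x. (1 - x) / (1 + x))"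
      by (intro continuous_intros) force
    fix x :: real assume "0 < x" "x < 1"
    then show "((\<lambda>x. (1 - x) / (1 + x)) has_real_derivative (- 2) * (1 / (1 + x)\<^sup>2)) (at x)"
      by (auto intro!: derivative_eq_intros simp: power2_eq_square)
  qed
  then show ?thesis by (simp only: moment_cmult xi0_eq_moment[OF assms]) simp
qed

text \<open>
  Integration by parts with \<open>\<phi> x = x / (1 + x)\<close>, whose derivative is the weight of \<open>M2\<close>, relates
  \<open>s * M1 s\<close> to \<open>M2 s\<close>. For \<open>xi2\<close> the same is done with \<open>\<phi> x = x / (1 + x)\<^sup>2\<close>.
\<close>
lemma xi1_eq_moment:
  assumes "s > 0"
  shows "xi1 s = M1 s"
proof -
  have "((\<lambda>x. x / (1 + x) * s * x powr (s - 1)) has_integral 1 / (1 + 1) - M2 s) {0..1}"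
  proof (rule has_integral_by_parts_moment[OF assms])
    show "continuous_on {0..1::real} (\<lambda>x. x / (1 + x))" by (intro continuous_intros) force
    fix x :: real assume "0 < x" "x < 1"
    then show "((\<lambda>x. x / (1 + x)) has_real_derivative 1 / (1 + x)\<^sup>2) (at x)"
      by (auto intro!: derivative_eq_intros simp: power2_eq_square)
  qed (rule continuous_weights)
  moreover have "((\<lambda>x. x / (1 + x) * s * x powr (s - 1)) has_integral s * M1 s) {0..1}"
  proof (rule has_integral_eq)
    show "((\<lambda>x. s * (1 / (1 + x) * x powr s)) has_integral s * M1 s) {0..1}"
      by (intro has_integral_mult_right moment_has_integral continuous_weights assms)
    fix x :: real assume "x \<in> {0..1}"
    then show "s * (1 / (1 + x) * x powr s) = x / (1 + x) * s * x powr (s - 1)"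
      by (cases "x = 0") (simp_all add: powr_diff)
  qed
  ultimately have "1 / (1 + 1) - M2 s = s * M1 s" by (rule has_integral_unique)
  then show ?thesis using assms by (simp add: xi1_def xi0_eq_moment field_simps)
qed

lemma xi2_eq_moment:
  assumes "s > 0"
  shows "xi2 s = 1 - 4 * M3 s"
proof -
  have "((\<lambda>x. x / (1 + x)\<^sup>2 * s * x powr (s - 1)) has_integral 1 / (1 + 1)\<^sup>2 - M3 s) {0..1}"
  proof (rule has_integral_by_parts_moment[OF assms])
    show "continuous_on {0..1::real} (\<lambda>x. x / (1 + x)\<^sup>2)" by (intro continuous_intros) force
    fix x :: real assume "0 < x" "x < 1"
    define y where "y = 1 + x"
    have y: "y \<noteq> 0" using \<open>0 < x\<close> by (simp add: y_def)
    have "((\<lambda>x. x / (1 + x)\<^sup>2) has_real_derivative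
        (1 * (1 + x)\<^sup>2 - x * (2 * (1 + x))) / ((1 + x)\<^sup>2 * (1 + x)\<^sup>2)) (at x)"
      using \<open>0 < x\<close> by (auto intro!: derivative_eq_intros)
    also have "(1 * (1 + x)\<^sup>2 - x * (2 * (1 + x))) / ((1 + x)\<^sup>2 * (1 + x)\<^sup>2)
        = y * (1 - x) / (y * y ^ 3)"
      unfolding y_def[symmetric]
      by (simp add: y_def power2_eq_square power3_eq_cube algebra_simps)
    also have "\<dots> = (1 - x) / (1 + x) ^ 3" using y by (simp add: y_def)
    finally show "((\<lambda>x. x / (1 + x)\<^sup>2) has_real_derivative (1 - x) / (1 + x) ^ 3) (at x)" .
  qed (rule continuous_weights)
  moreover have "((\<lambda>x. x / (1 + x)\<^sup>2 * s * x powr (s - 1)) has_integral s * M2 s) {0..1}"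
  proof (rule has_integral_eq)
    show "((\<lambda>x. s * (1 / (1 + x)\<^sup>2 * x powr s)) has_integral s * M2 s) {0..1}"
      by (intro has_integral_mult_right moment_has_integral continuous_weights assms)
    fix x :: real assume "x \<in> {0..1}"
    then show "s * (1 / (1 + x)\<^sup>2 * x powr s) = x / (1 + x)\<^sup>2 * s * x powr (s - 1)"
      by (cases "x = 0") (simp_all add: powr_diff)
  qed
  ultimately have "1 / (1 + 1)\<^sup>2 - M3 s = s * M2 s" by (rule has_integral_unique)
  then show ?thesis using assms by (simp add: xi2_def xi0_eq_moment field_simps)
qed

lemma xi3_eq_quotient: "xi3 = (\<lambda>s. xi1 s / xi0 s)"
  by (simp add: fun_eq_iff xi3_def xi1_def)

lemma xi0_pos: "s > 0 \<Longrightarrow> xi0 s > 0"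
  by (simp add: xi0_eq_moment moment_pos continuous_weights)

lemma xi_strict_mono:
  "strict_antimono_on {0<..} xi0" "strict_antimono_on {0<..} xi1" "strict_mono_on {0<..} xi2"
  by (auto simp: monotone_on_def xi0_eq_moment xi1_eq_moment xi2_eq_moment
      intro!: moment_strict_antimono continuous_weights)

lemma xi3_strict_mono: "strict_mono_on {0<..} xi3"
proof (rule strict_mono_onI)
  fix s t :: real assume st: "s \<in> {0<..}" "t \<in> {0<..}" "s < t"
  have eq: "xi3 r = moment (\<lambda>x. (1 + x) / 2 * (1 / (1 + x)\<^sup>2)) r / M2 r" if "r > 0" for r
  proof -
    have "moment (\<lambda>x. (1 + x) / 2 * (1 / (1 + x)\<^sup>2)) r = moment (\<lambda>x. 1 / 2 * (1 / (1 + x))) r"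
      unfolding moment_def by (rule integral_cong) (simp add: power2_eq_square)
    then show ?thesis using that
      by (simp only: moment_cmult xi3_eq_quotient xi1_eq_moment xi0_eq_moment)
  qed
  have "moment (\<lambda>x. (1 + x) / 2 * (1 / (1 + x)\<^sup>2)) s / M2 s
      < moment (\<lambda>x. (1 + x) / 2 * (1 / (1 + x)\<^sup>2)) t / M2 t"
    by (rule weighted_mean_strict_mono)
       (use st in \<open>auto intro!: continuous_intros strict_mono_onI\<close>)
  then show "xi3 s < xi3 t" using st by (simp add: eq)
qed

section \<open>The derivative of \<open>xi0\<close>\<close>

lemma xi0_field_differentiable:
  assumes "s > 0" shows "xi0 field_differentiable at s"
proof -
  have "(xi0 has_real_derivative 2 * integral {0..1} (\<lambda>x. 1 / (1 + x)\<^sup>2 * (x powr s * ln x))) (at s)"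
    by (rule has_field_derivative_transform_within_open[of _ _ _ "{0<..}",
          OF DERIV_cmult[OF moment_has_derivative[OF continuous_weights(2) assms]]])
       (use assms in \<open>auto simp: xi0_eq_moment\<close>)
  then show ?thesis by (auto simp: field_differentiable_def)
qed

text \<open>
  With \<open>a = - ln x\<close> and \<open>d = (t - s) * a\<close> the claim is \<open>1 + t * a < (1 + s * a) * exp d\<close>. It follows
  from \<open>1 + d < exp d\<close>, since \<open>(1 + s * a) * (1 + d)\<close> exceeds \<open>1 + t * a\<close> by \<open>s * a * d\<close>.
\<close>
lemma one_minus_ln_powr_strict_antimono:
  fixes x :: real
  assumes "0 < x" "x < 1" "0 < s" "s < t"
  shows "x powr t * (1 - t * ln x) < x powr s * (1 - s * ln x)"
proof -
  define a where "a = - ln x"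
  have a: "a > 0" using assms by (simp add: a_def)
  define d where "d = (t - s) * a"
  have d: "d > 0" using a assms by (simp add: d_def)
  have "1 + t * a \<le> (1 + s * a) * (1 + d)"
    using a d assms by (simp add: d_def algebra_simps)
  also have "\<dots> < (1 + s * a) * exp d"
    using exp_minus_greater[of "- d"] a d assms
    by (intro mult_strict_left_mono) (auto simp: add_pos_pos)
  finally have "exp (- (t * a)) * (1 + t * a) < exp (- (t * a)) * ((1 + s * a) * exp d)"
    by simp
  also have "\<dots> = exp (- (s * a)) * (1 + s * a)"
    by (simp add: d_def algebra_simps flip: exp_add)
  finally show ?thesis using assms by (simp add: a_def powr_def)
qed

text \<open>
  Differentiating \<open>2 * M2 s\<close> directly gives an integrand whose monotonicity in \<open>s\<close> is not visible.
  The quotient \<open>xi2 s / (2 * s)\<close> is differentiated instead: the factor \<open>s\<^sup>2\<close> cancels its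
  denominator.
\<close>
lemma square_deriv_xi0:
  assumes "s > 0"
  shows "s\<^sup>2 * deriv xi0 s =
    2 * integral {0..1} (\<lambda>x. (1 - x) / (1 + x) ^ 3 * (x powr s * (1 - s * ln x))) - 1 / 2"
proof -
  define w where "w = (\<lambda>x::real. (1 - x) / (1 + x) ^ 3)"
  have w: "continuous_on {0..1} w" unfolding w_def by (rule continuous_weights)
  define D where "D = integral {0..1} (\<lambda>x. w x * (x powr s * ln x))"
  have xi: "xi0 r = (1 - 4 * moment w r) / (2 * r)" if "r > 0" for r
    using xi2_eq_moment[OF that] that by (simp add: w_def xi2_def field_simps)
  have "((\<lambda>r. (1 - 4 * moment w r) / (2 * r)) has_real_derivative
      (- 4 * D * (2 * s) - (1 - 4 * moment w s) * 2) / ((2 * s) * (2 * s))) (at s)"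
    using assms moment_has_derivative[OF w assms, folded D_def]
    by (auto intro!: derivative_eq_intros)
  then have "(xi0 has_real_derivative
      (- 4 * D * (2 * s) - (1 - 4 * moment w s) * 2) / ((2 * s) * (2 * s))) (at s)"
    by (rule has_field_derivative_transform_within_open[of _ _ _ "{0<..}"])
       (use assms xi in auto)
  then have "s\<^sup>2 * deriv xi0 s = 2 * (moment w s - s * D) - 1 / 2"
    using assms by (simp add: DERIV_imp_deriv field_simps power2_eq_square)
  also have "((\<lambda>x. w x * x powr s - s * (w x * (x powr s * ln x))) has_integral
      moment w s - s * D) {0..1}"
    unfolding D_def
    by (intro has_integral_diff has_integral_mult_right moment_has_integral integrable_integral
        integrable_continuous_real continuous_intros w assms)
  then have "moment w s - s * D = integral {0..1} (\<lambda>x. w x * (x powr s * (1 - s * ln x)))"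
    by (intro integral_unique[symmetric]) (simp add: algebra_simps)
  finally show ?thesis by (simp add: w_def)
qed

lemma square_deriv_xi0_strict_antimono:
  "strict_antimono_on {0<..} (\<lambda>s. s\<^sup>2 * deriv xi0 s)"
proof (rule monotone_onI)
  fix s t :: real assume st: "s \<in> {0<..}" "t \<in> {0<..}" "s < t"
  have cont: "continuous_on {0..1} (\<lambda>x::real. (1 - x) / (1 + x) ^ 3 * (x powr r * (1 - r * ln x)))"
    if "r > 0" for r
  proof -
    have "continuous_on {0..1} (\<lambda>x::real. (1 - x) / (1 + x) ^ 3 * (x powr r - r * (x powr r * ln x)))"
      by (intro continuous_on_mult[OF continuous_weights(3)] continuous_intros that)
    then show ?thesis by (simp add: algebra_simps)
  qed
  have "integral {0..1} (\<lambda>x. (1 - x) / (1 + x) ^ 3 * (x powr t * (1 - t * ln x)))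
      < integral {0..1} (\<lambda>x. (1 - x) / (1 + x) ^ 3 * (x powr s * (1 - s * ln x)))"
    using st by (intro integral_less_real cont mult_strict_left_mono one_minus_ln_powr_strict_antimono) auto
  then show "s\<^sup>2 * deriv xi0 s > t\<^sup>2 * deriv xi0 t"
    using st by (simp add: square_deriv_xi0)
qed

section \<open>Continuity, limits and ranges\<close>

lemma xi_continuous:
  "continuous_on {0<..} xi0" "continuous_on {0<..} xi1"
  "continuous_on {0<..} xi2" "continuous_on {0<..} xi3"
proof -
  show c0: "continuous_on {0<..} xi0"
    using continuous_on_mult_left[OF continuous_on_moment[OF continuous_weights(2)], of 2]
    by (rule continuous_on_eq) (simp add: xi0_eq_moment)
  show "continuous_on {0<..} xi1" "continuous_on {0<..} xi2" "continuous_on {0<..} xi3"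
    unfolding xi1_def xi2_def xi3_def using xi0_pos
    by (force intro!: continuous_intros c0)+
qed

lemma integral_weights:
  "integral {0..1} (\<lambda>x::real. 1 / (1 + x)) = ln 2"
  "integral {0..1} (\<lambda>x::real. 1 / (1 + x)\<^sup>2) = 1 / 2"
proof -
  have "((\<lambda>x. 1 / (1 + x)) has_integral ln (1 + 1) - ln (1 + 0 :: real)) {0..1}"
    by (rule fundamental_theorem_of_calculus)
       (auto intro!: derivative_eq_intros simp flip: has_real_derivative_iff_has_vector_derivative)
  then show "integral {0..1} (\<lambda>x::real. 1 / (1 + x)) = ln 2" by (simp add: integral_unique)
  have "((\<lambda>x::real. 1 / (1 + x)\<^sup>2) has_integral - (1 / (1 + 1)) - - (1 / (1 + 0))) {0..1}"
    by (rule fundamental_theorem_of_calculus)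
       (auto intro!: derivative_eq_intros simp: power2_eq_square
         simp flip: has_real_derivative_iff_has_vector_derivative)
  then show "integral {0..1} (\<lambda>x::real. 1 / (1 + x)\<^sup>2) = 1 / 2" by (simp add: integral_unique)
qed

lemma xi_tendsto_at_right_0:
  "(xi0 \<longlongrightarrow> 1) (at_right 0)" "(xi1 \<longlongrightarrow> ln 2) (at_right 0)"
  "(xi2 \<longlongrightarrow> 0) (at_right 0)" "(xi3 \<longlongrightarrow> ln 2) (at_right 0)"
proof -
  have "((\<lambda>s. 2 * M2 s) \<longlongrightarrow> 2 * (1 / 2)) (at_right 0)"
    using moment_tendsto_at_right_0[OF continuous_weights(2)]
    by (intro tendsto_intros) (simp add: integral_weights)
  then have "((\<lambda>s. 2 * M2 s) \<longlongrightarrow> 1) (at_right 0)" by simp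
  then show 0: "(xi0 \<longlongrightarrow> 1) (at_right 0)"
    by (rule Lim_transform_eventually)
       (auto simp: xi0_eq_moment intro!: eventually_mono[OF eventually_at_right_less[of 0]])
  have "(M1 \<longlongrightarrow> ln 2) (at_right 0)"
    using moment_tendsto_at_right_0[OF continuous_weights(1)] by (simp add: integral_weights)
  then show 1: "(xi1 \<longlongrightarrow> ln 2) (at_right 0)"
    by (rule Lim_transform_eventually)
       (auto simp: xi1_eq_moment intro!: eventually_mono[OF eventually_at_right_less[of 0]])
  have "((\<lambda>s. 2 * s * xi0 s) \<longlongrightarrow> 2 * 0 * 1) (at_right 0)" by (intro tendsto_intros 0)
  then show "(xi2 \<longlongrightarrow> 0) (at_right 0)" by (simp add: xi2_def[abs_def])
  have "((\<lambda>s. xi1 s / xi0 s) \<longlongrightarrow> ln 2 / 1) (at_right 0)" by (intro tendsto_intros 0 1) auto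
  then show "(xi3 \<longlongrightarrow> ln 2) (at_right 0)" by (simp add: xi3_eq_quotient)
qed

lemma xi_tendsto_at_top:
  "(xi0 \<longlongrightarrow> 0) at_top" "(xi1 \<longlongrightarrow> 0) at_top" "(xi2 \<longlongrightarrow> 1) at_top" "(xi3 \<longlongrightarrow> 1) at_top"
proof -
  note lim = moment_tendsto_at_top[OF continuous_weights(1)]
    moment_tendsto_at_top[OF continuous_weights(2)] moment_tendsto_at_top[OF continuous_weights(3)]
  have "((\<lambda>s. 2 * M2 s) \<longlongrightarrow> 0) at_top" using lim by (auto intro!: tendsto_eq_intros)
  then show 0: "(xi0 \<longlongrightarrow> 0) at_top"
    by (rule Lim_transform_eventually)
       (auto simp: xi0_eq_moment intro!: eventually_mono[OF eventually_gt_at_top[of 0]])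
  show "(xi1 \<longlongrightarrow> 0) at_top"
    using lim(1) by (rule Lim_transform_eventually)
       (auto simp: xi1_eq_moment intro!: eventually_mono[OF eventually_gt_at_top[of 0]])
  have "((\<lambda>s. 1 - 4 * M3 s) \<longlongrightarrow> 1) at_top" using lim by (auto intro!: tendsto_eq_intros)
  then show 2: "(xi2 \<longlongrightarrow> 1) at_top"
    by (rule Lim_transform_eventually)
       (auto simp: xi2_eq_moment intro!: eventually_mono[OF eventually_gt_at_top[of 0]])
  (* xi1 / xi0 is of the form 0 / 0 here, so xi3 is written over xi2 instead. *)
  have "((\<lambda>s. (1 - xi0 s) / xi2 s) \<longlongrightarrow> (1 - 0) / 1) at_top" by (intro tendsto_intros 0 2) auto
  then show "(xi3 \<longlongrightarrow> 1) at_top" by (simp add: xi3_def[abs_def] xi2_def)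
qed

theorem theorem2p4:
  "(\<forall>s>0. complex_of_real (xi0 s) =
        2 * hyp2F1 1 (complex_of_real s) (complex_of_real s + 1) (-1) - 1 \<and>
      ((\<lambda>x. (1 - x) / (1 + x) * s * x powr (s - 1)) has_integral xi0 s) {0..1}) \<and>
   (continuous_on {0<..} xi0 \<and> continuous_on {0<..} xi1 \<and>
      continuous_on {0<..} xi2 \<and> continuous_on {0<..} xi3) \<and>
   (strict_antimono_on {0<..} xi0 \<and> xi0 ` {0<..} = {0<..<1} \<and>
      (\<forall>s>0. xi0 field_differentiable at s) \<and>
      strict_antimono_on {0<..} (\<lambda>s. s\<^sup>2 * deriv xi0 s)) \<and>
   (strict_antimono_on {0<..} xi1 \<and> xi1 ` {0<..} = {0<..<ln 2}) \<and>
   (strict_mono_on {0<..} xi2 \<and> xi2 ` {0<..} = {0<..<1}) \<and>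
   (strict_mono_on {0<..} xi3 \<and> xi3 ` {0<..} = {ln 2<..<1}) \<and>
   (\<forall>f\<in>{xi0, xi1, xi2, xi3}.
      (\<exists>g. continuous_on {0..} g \<and> (\<forall>s>0. g s = f s)) \<and>
      (\<exists>L. (f \<longlongrightarrow> L) (at_right 0)) \<and>
      (\<exists>L. (f \<longlongrightarrow> L) at_top))"
proof (intro conjI allI impI ballI)
  fix s :: real assume "s > 0"
  then show "complex_of_real (xi0 s) = 2 * hyp2F1 1 (complex_of_real s) (complex_of_real s + 1) (-1) - 1"
    by (simp add: hyp2F1_eq_moment xi0_eq_moment)
next
  show "xi0 ` {0<..} = {0<..<1}" "xi1 ` {0<..} = {0<..<ln 2}"
    by (intro antitone_image_onto xi_continuous xi_strict_mono xi_tendsto_at_right_0 xi_tendsto_at_top)+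
  show "xi2 ` {0<..} = {0<..<1}" "xi3 ` {0<..} = {ln 2<..<1}"
    by (intro monotone_image_onto xi_continuous xi_strict_mono xi3_strict_mono
        xi_tendsto_at_right_0 xi_tendsto_at_top)+
next
  fix f assume f: "f \<in> {xi0, xi1, xi2, xi3}"
  then show lim0: "\<exists>L. (f \<longlongrightarrow> L) (at_right 0)" and "\<exists>L. (f \<longlongrightarrow> L) at_top"
    using xi_tendsto_at_right_0 xi_tendsto_at_top by auto
  have "continuous_on {0<..} f" using f xi_continuous by auto
  then show "\<exists>g. continuous_on {0..} g \<and> (\<forall>s>0. g s = f s)"
    using lim0 continuous_extension_to_0 by blast
qed (use xi_continuous xi_strict_mono xi3_strict_mono xi0_field_differentiable
    square_deriv_xi0_strict_antimono xi0_has_integral in auto)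

end
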